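(* Let $\mathcal{C}$ be an equational class of algebras. If $\mathcal{C}$ is semi-degenerate and has equationally definable principal congruences (EDPC), then every admissible morphism in $\mathcal{C}$ fulfills GU.
   Context: An equational class (variety) $\mathcal{C}$ of algebras of a fixed type is semi-degenerate if no non-trivial algebra in $\mathcal{C}$ has a one-element subalgebra. All algebras are non-empty; a morphism in $\mathcal{C}$ is a homomorphism between members of $\mathcal{C}$. For an algebra $M$, $\mathrm{Con}(M)$ is its congruence lattice, $\nabla_M=M^2$, and $Cg_M(a,b)$ is the congruence of $M$ generated by $(a,b)$. $\mathcal{C}$ has EDPC if there exist an integer $n\geq1$ and $4$-ary terms $p_1,q_1,\ldots,p_n,q_n$ in the language of $\mathcal{C}$ such that, for every algebra $M$ in $\mathcal{C}$ and all $a,b\in M$, $Cg_M(a,b)=\{(c,d)\in M^2 : p_i^M(a,b,c,d)=q_i^M(a,b,c,d)\text{ for all } i\in\{1,\ldots,n\}\}$. A class with EDPC is congruence-distributive (all its members have distributive congruence lattices), and hence the (modular) commutator of congruences in its members is the intersection; so a congruence $\phi\neq\nabla_M$ is prime if, for all $\alpha,\beta\in\mathrm{Con}(M)$, $\alpha\cap\beta\subseteq\phi$ implies $\alpha\subseteq\phi$ or $\beta\subseteq\phi$; $\mathrm{Spec}(M)$ is the set of prime congruences of $M$. For a morphism $f:A\to B$ and $\psi\in\mathrm{Con}(B)$, $f^*(\psi)=\{(x,y)\in A^2 : (f(x),f(y))\in\psi\}\in\mathrm{Con}(A)$. $f$ is admissible if $f^*(\psi)\in\mathrm{Spec}(A)$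 for all $\psi\in\mathrm{Spec}(B)$. An admissible morphism $f:A\to B$ fulfills GU (Going Up) if for all $\phi,\psi\in\mathrm{Spec}(A)$ and $\phi_1\in\mathrm{Spec}(B)$ with $\phi\subseteq\psi$ and $f^*(\phi_1)=\phi$ there is $\psi_1\in\mathrm{Spec}(B)$ with $\phi_1\subseteq\psi_1$ and $f^*(\psi_1)=\psi$. *)

theory Defs
  imports Main
begin

(* A type (signature) of algebras is a partial map ty: the operation symbols are dom ty, and
   ty f = Some n says that f is n-ary (n = 0 gives a constant); so the set of symbols may be empty.
   The values opn M f xs are relevant only if ty f = Some (length xs) and set xs <= univ M.

   The type variable 'u is the universe of discourse: a class of algebras consists of algebras whose
   universes are subsets of 'u. No assumption is made on 'u. Up to isomorphism, subalgebras and
   quotients of algebras over 'u are again algebras over 'u. *)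

record ('f, 'u) algebra =
  univ :: "'u set"
  opn :: "'f \<Rightarrow> 'u list \<Rightarrow> 'u"

definition is_algebra :: "('f \<rightharpoonup> nat) \<Rightarrow> ('f, 'u) algebra \<Rightarrow> bool" where
  "is_algebra ty M \<longleftrightarrow> univ M \<noteq> {} \<and>
     (\<forall>f xs. ty f = Some (length xs) \<and> set xs \<subseteq> univ M \<longrightarrow> opn M f xs \<in> univ M)"

definition is_subalgebra :: "('f \<rightharpoonup> nat) \<Rightarrow> 'u set \<Rightarrow> ('f, 'u) algebra \<Rightarrow> bool" where
  "is_subalgebra ty S M \<longleftrightarrow> S \<subseteq> univ M \<and> is_algebra ty (M\<lparr>univ := S\<rparr>)"

definition is_hom :: "('f \<rightharpoonup> nat) \<Rightarrow> ('f, 'u) algebra \<Rightarrow> ('f, 'u) algebra \<Rightarrow> ('u \<Rightarrow> 'u) \<Rightarrow> bool" where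
  "is_hom ty A B h \<longleftrightarrow> (\<forall>x\<in>univ A. h x \<in> univ B) \<and>
     (\<forall>f xs. ty f = Some (length xs) \<and> set xs \<subseteq> univ A \<longrightarrow>
        h (opn A f xs) = opn B f (map h xs))"


datatype 'f trm = Var nat | App 'f "'f trm list"

primrec vars :: "'f trm \<Rightarrow> nat set" where
  "vars (Var i) = {i}"
| "vars (App f ts) = \<Union> (set (map vars ts))"

primrec is_term :: "('f \<rightharpoonup> nat) \<Rightarrow> 'f trm \<Rightarrow> bool" where
  "is_term ty (Var i) = True"
| "is_term ty (App f ts) = (ty f = Some (length ts) \<and> list_all id (map (is_term ty) ts))"

primrec eval :: "('f, 'u) algebra \<Rightarrow> (nat \<Rightarrow> 'u) \<Rightarrow> 'f trm \<Rightarrow> 'u" where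
  "eval M v (Var i) = v i"
| "eval M v (App f ts) = opn M f (map (eval M v) ts)"

(* 4-ary terms are the terms in the variables 0, 1, 2, 3. *)

definition is_term4 :: "('f \<rightharpoonup> nat) \<Rightarrow> 'f trm \<Rightarrow> bool" where
  "is_term4 ty t \<longleftrightarrow> is_term ty t \<and> vars t \<subseteq> {..<4}"

definition eval4 :: "('f, 'u) algebra \<Rightarrow> 'f trm \<Rightarrow> 'u \<Rightarrow> 'u \<Rightarrow> 'u \<Rightarrow> 'u \<Rightarrow> 'u" where
  "eval4 M t a b c d = eval M (\<lambda>i. [a, b, c, d] ! i) t"

definition satisfies :: "('f, 'u) algebra \<Rightarrow> 'f trm \<times> 'f trm \<Rightarrow> bool" where
  "satisfies M e \<longleftrightarrow> (\<forall>v. range v \<subseteq> univ M \<longrightarrow> eval M v (fst e) = eval M v (snd e))"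

definition equational_class :: "('f \<rightharpoonup> nat) \<Rightarrow> ('f, 'u) algebra set \<Rightarrow> bool" where
  "equational_class ty C \<longleftrightarrow>
     (\<exists>E. (\<forall>e\<in>E. is_term ty (fst e) \<and> is_term ty (snd e)) \<and>
          C = {M. is_algebra ty M \<and> (\<forall>e\<in>E. satisfies M e)})"

definition semi_degenerate :: "('f \<rightharpoonup> nat) \<Rightarrow> ('f, 'u) algebra set \<Rightarrow> bool" where
  "semi_degenerate ty C \<longleftrightarrow>
     (\<forall>M\<in>C. (\<exists>x\<in>univ M. \<exists>y\<in>univ M. x \<noteq> y) \<longrightarrow> \<not> (\<exists>e. is_subalgebra ty {e} M))"


definition Con :: "('f \<rightharpoonup> nat) \<Rightarrow> ('f, 'u) algebra \<Rightarrow> ('u \<times> 'u) set set" where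
  "Con ty M = {\<theta>. equiv (univ M) \<theta> \<and>
     (\<forall>f xs ys. ty f = Some (length xs) \<and> list_all2 (\<lambda>x y. (x, y) \<in> \<theta>) xs ys \<longrightarrow>
        (opn M f xs, opn M f ys) \<in> \<theta>)}"

definition nabla :: "('f, 'u) algebra \<Rightarrow> ('u \<times> 'u) set" where
  "nabla M = univ M \<times> univ M"

definition Cg :: "('f \<rightharpoonup> nat) \<Rightarrow> ('f, 'u) algebra \<Rightarrow> 'u \<Rightarrow> 'u \<Rightarrow> ('u \<times> 'u) set" where
  "Cg ty M a b = \<Inter> {\<theta> \<in> Con ty M. (a, b) \<in> \<theta>}"

definition EDPC :: "('f \<rightharpoonup> nat) \<Rightarrow> ('f, 'u) algebra set \<Rightarrow> bool" where
  "EDPC ty C \<longleftrightarrow>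
     (\<exists>n\<ge>1. \<exists>p q :: nat \<Rightarrow> 'f trm.
        (\<forall>i\<in>{1..n}. is_term4 ty (p i) \<and> is_term4 ty (q i)) \<and>
        (\<forall>M\<in>C. \<forall>a\<in>univ M. \<forall>b\<in>univ M.
           Cg ty M a b = {(c, d) \<in> univ M \<times> univ M.
             \<forall>i\<in>{1..n}. eval4 M (p i) a b c d = eval4 M (q i) a b c d}))"

(* Prime congruences are defined through the commutator; in a congruence-distributive (hence in any
   EDPC) equational class the commutator is the intersection, which is what is used here. *)

definition Spec :: "('f \<rightharpoonup> nat) \<Rightarrow> ('f, 'u) algebra \<Rightarrow> ('u \<times> 'u) set set" where
  "Spec ty M = {\<phi> \<in> Con ty M. \<phi> \<noteq> nabla M \<and>
     (\<forall>\<alpha>\<in>Con ty M. \<forall>\<beta>\<in>Con ty M. \<alpha> \<inter> \<beta> \<subseteq> \<phi> \<longrightarrow> \<alpha> \<subseteq> \<phi> \<or> \<beta> \<subseteq> \<phi>)}"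

definition pullback :: "('f, 'u) algebra \<Rightarrow> ('u \<Rightarrow> 'u) \<Rightarrow> ('u \<times> 'u) set \<Rightarrow> ('u \<times> 'u) set" where
  "pullback A f \<psi> = {(x, y) \<in> univ A \<times> univ A. (f x, f y) \<in> \<psi>}"

definition admissible :: "('f \<rightharpoonup> nat) \<Rightarrow> ('f, 'u) algebra \<Rightarrow> ('f, 'u) algebra \<Rightarrow> ('u \<Rightarrow> 'u) \<Rightarrow> bool" where
  "admissible ty A B f \<longleftrightarrow> (\<forall>\<psi>\<in>Spec ty B. pullback A f \<psi> \<in> Spec ty A)"

definition GU :: "('f \<rightharpoonup> nat) \<Rightarrow> ('f, 'u) algebra \<Rightarrow> ('f, 'u) algebra \<Rightarrow> ('u \<Rightarrow> 'u) \<Rightarrow> bool" where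
  "GU ty A B f \<longleftrightarrow>
     (\<forall>\<phi>\<in>Spec ty A. \<forall>\<psi>\<in>Spec ty A. \<forall>\<phi>\<^sub>1\<in>Spec ty B.
        \<phi> \<subseteq> \<psi> \<and> pullback A f \<phi>\<^sub>1 = \<phi> \<longrightarrow>
        (\<exists>\<psi>\<^sub>1\<in>Spec ty B. \<phi>\<^sub>1 \<subseteq> \<psi>\<^sub>1 \<and> pullback A f \<psi>\<^sub>1 = \<psi>))"

end

(* By EDPC applied to quotient algebras, theta \<or> Cg(a,b) consists of the pairs (c,d) with
   p_i(a,b,c,d) theta q_i(a,b,c,d) for all i. Iterating this, the join of theta with a finitely
   generated congruence is described by term conditions "modulo theta", and such a description
   visibly commutes with intersections in theta (whence distributivity) and with pullbacks along
   homomorphisms (whence congruence extension). By congruence extension, the congruence generated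
   by phi_1 and f(psi) pulls back into psi. A congruence above it that is maximal with pullback
   inside psi is prime, because pullback commutes with intersections, psi is prime and the
   congruence lattice of B is distributive. *)
theory Submission
  imports Defs
begin

section \<open>Congruences, pullbacks and unions\<close>

lemma ConI:
  assumes "\<theta> \<subseteq> univ M \<times> univ M"
    and "\<And>x. x \<in> univ M \<Longrightarrow> (x, x) \<in> \<theta>"
    and "\<And>x y. (x, y) \<in> \<theta> \<Longrightarrow> (y, x) \<in> \<theta>"
    and "\<And>x y z. (x, y) \<in> \<theta> \<Longrightarrow> (y, z) \<in> \<theta> \<Longrightarrow> (x, z) \<in> \<theta>"
    and "\<And>f xs ys. ty f = Some (length xs) \<Longrightarrow> list_all2 (\<lambda>x y. (x, y) \<in> \<theta>) xs ys \<Longrightarrow>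
           (opn M f xs, opn M f ys) \<in> \<theta>"
  shows "\<theta> \<in> Con ty M"
proof -
  have "equiv (univ M) \<theta>"
    using assms(1-4) by (intro equivI refl_onI symI transI) blast+
  then show ?thesis using assms(5) by (simp add: Con_def)
qed

lemma Con_subset: "\<theta> \<in> Con ty M \<Longrightarrow> \<theta> \<subseteq> univ M \<times> univ M"
  by (simp add: Con_def equiv_type)

lemma Con_refl: "\<theta> \<in> Con ty M \<Longrightarrow> x \<in> univ M \<Longrightarrow> (x, x) \<in> \<theta>"
  by (auto simp: Con_def equiv_def refl_on_def)

lemma Con_sym: "\<theta> \<in> Con ty M \<Longrightarrow> (x, y) \<in> \<theta> \<Longrightarrow> (y, x) \<in> \<theta>"
  by (auto simp: Con_def equiv_def sym_def)

lemma Con_trans: "\<theta> \<in> Con ty M \<Longrightarrow> (x, y) \<in> \<theta> \<Longrightarrow> (y, z) \<in> \<theta> \<Longrightarrow> (x, z) \<in> \<theta>"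
  unfolding Con_def equiv_def by (blast dest: transD)

lemma Con_opn:
  "\<theta> \<in> Con ty M \<Longrightarrow> ty f = Some (length xs) \<Longrightarrow> list_all2 (\<lambda>x y. (x, y) \<in> \<theta>) xs ys \<Longrightarrow>
    (opn M f xs, opn M f ys) \<in> \<theta>"
  by (simp add: Con_def)

lemma list_all2_in_Times:
  "list_all2 (\<lambda>x y. (x, y) \<in> \<theta>) xs ys \<Longrightarrow> \<theta> \<subseteq> A \<times> B \<Longrightarrow> set xs \<subseteq> A \<and> set ys \<subseteq> B"
  by (induction rule: list_all2_induct) auto

lemma nabla_in_Con:
  assumes "is_algebra ty M"
  shows "nabla M \<in> Con ty M"
proof (rule ConI)
  fix f xs ys
  assume f: "ty f = Some (length xs)" and xs: "list_all2 (\<lambda>x y. (x, y) \<in> nabla M) xs ys"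
  have "set xs \<subseteq> univ M \<and> set ys \<subseteq> univ M"
    using list_all2_in_Times[OF xs, of "univ M" "univ M"] by (simp add: nabla_def)
  then show "(opn M f xs, opn M f ys) \<in> nabla M"
    using assms f list_all2_lengthD[OF xs] by (simp add: is_algebra_def nabla_def)
qed (auto simp: nabla_def)

text \<open>The family must be nonempty: the empty intersection is the full relation on the type,
  which need not lie inside \<open>univ M \<times> univ M\<close>.\<close>

lemma Inter_in_Con:
  assumes "\<Theta> \<noteq> {}" "\<Theta> \<subseteq> Con ty M"
  shows "\<Inter>\<Theta> \<in> Con ty M"
proof (rule ConI)
  show "\<Inter>\<Theta> \<subseteq> univ M \<times> univ M"
    using assms Con_subset by blast
next
  fix x y z
  show "x \<in> univ M \<Longrightarrow> (x, x) \<in> \<Inter>\<Theta>"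
    using assms Con_refl[of _ ty M x] by blast
  show "(x, y) \<in> \<Inter>\<Theta> \<Longrightarrow> (y, x) \<in> \<Inter>\<Theta>"
    using assms Con_sym[of _ ty M x y] by blast
  show "(x, y) \<in> \<Inter>\<Theta> \<Longrightarrow> (y, z) \<in> \<Inter>\<Theta> \<Longrightarrow> (x, z) \<in> \<Inter>\<Theta>"
    using assms Con_trans[of _ ty M x y z] by blast
next
  fix f xs ys
  assume f: "ty f = Some (length xs)" and xs: "list_all2 (\<lambda>x y. (x, y) \<in> \<Inter>\<Theta>) xs ys"
  show "(opn M f xs, opn M f ys) \<in> \<Inter>\<Theta>"
  proof
    fix \<theta> assume "\<theta> \<in> \<Theta>"
    then show "(opn M f xs, opn M f ys) \<in> \<theta>"
      using assms f xs by (blast intro: Con_opn list_all2_mono)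
  qed
qed

lemma Int_in_Con: "\<alpha> \<in> Con ty M \<Longrightarrow> \<beta> \<in> Con ty M \<Longrightarrow> \<alpha> \<inter> \<beta> \<in> Con ty M"
  using Inter_in_Con[of "{\<alpha>, \<beta>}" ty M] by simp

lemma Cg_in_Con:
  assumes "is_algebra ty M" "a \<in> univ M" "b \<in> univ M"
  shows "Cg ty M a b \<in> Con ty M"
  \<comment> \<open>\<open>nabla M\<close> contains every pair of elements, so the intersected
    family is nonempty.\<close>
  unfolding Cg_def using nabla_in_Con[OF assms(1)] assms(2,3)
  by (intro Inter_in_Con) (auto simp: nabla_def)

section \<open>Directed unions of congruences\<close>

text \<open>Argument lists are finite, so the members witnessing the single pairs have a common
  upper bound in the directed family. This gives compatibility of a directed union with the
  operations.\<close>

lemma list_all2_directed_Union: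
  assumes "\<Theta> \<noteq> {}"
    and "\<And>\<alpha> \<beta>. \<alpha> \<in> \<Theta> \<Longrightarrow> \<beta> \<in> \<Theta> \<Longrightarrow> \<exists>\<gamma>\<in>\<Theta>. \<alpha> \<union> \<beta> \<subseteq> \<gamma>"
    and "list_all2 (\<lambda>x y. (x, y) \<in> \<Union>\<Theta>) xs ys"
  shows "\<exists>\<gamma>\<in>\<Theta>. list_all2 (\<lambda>x y. (x, y) \<in> \<gamma>) xs ys"
  using assms(3)
proof (induction rule: list_all2_induct)
  case Nil
  then show ?case using assms(1) by auto
next
  case (Cons x xs y ys)
  then obtain \<alpha> \<beta> where "\<alpha> \<in> \<Theta>" "\<beta> \<in> \<Theta>" "(x, y) \<in> \<alpha>" "list_all2 (\<lambda>x y. (x, y) \<in> \<beta>) xs ys"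
    by blast
  moreover from this obtain \<gamma> where "\<gamma> \<in> \<Theta>" "\<alpha> \<subseteq> \<gamma>" "\<beta> \<subseteq> \<gamma>"
    using assms(2) by (metis le_sup_iff)
  ultimately have "list_all2 (\<lambda>x y. (x, y) \<in> \<gamma>) (x # xs) (y # ys)"
    by (auto elim: list_all2_mono)
  with \<open>\<gamma> \<in> \<Theta>\<close> show ?case by blast
qed

text \<open>Each closure condition involves only finitely many pairs, and by directedness these
  already lie in one member. It serves both for unions over finite lists of generators and for
  chains in Zorn's lemma.\<close>

lemma directed_Union_in_Con:
  assumes "\<Theta> \<noteq> {}" "\<Theta> \<subseteq> Con ty M"
    and directed: "\<And>\<alpha> \<beta>. \<alpha> \<in> \<Theta> \<Longrightarrow> \<beta> \<in> \<Theta> \<Longrightarrow> \<exists>\<gamma>\<in>\<Theta>. \<alpha> \<union> \<beta> \<subseteq> \<gamma>"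
  shows "\<Union>\<Theta> \<in> Con ty M"
proof (rule ConI)
  show "\<Union>\<Theta> \<subseteq> univ M \<times> univ M"
    using assms(2) Con_subset by blast
next
  fix x y z
  show "x \<in> univ M \<Longrightarrow> (x, x) \<in> \<Union>\<Theta>"
    using assms(1,2) Con_refl[of _ ty M x] by blast
  show "(x, y) \<in> \<Union>\<Theta> \<Longrightarrow> (y, x) \<in> \<Union>\<Theta>"
    using assms(2) Con_sym[of _ ty M x y] by blast
  assume "(x, y) \<in> \<Union>\<Theta>" "(y, z) \<in> \<Union>\<Theta>"
  then obtain \<alpha> \<beta> where "\<alpha> \<in> \<Theta>" "\<beta> \<in> \<Theta>" "(x, y) \<in> \<alpha>" "(y, z) \<in> \<beta>" by blast
  with directed obtain \<gamma> where "\<gamma> \<in> \<Theta>" "(x, y) \<in> \<gamma>" "(y, z) \<in> \<gamma>" by blast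
  then show "(x, z) \<in> \<Union>\<Theta>" using assms(2) Con_trans[of \<gamma> ty M x y z] by blast
next
  fix f xs ys
  assume "ty f = Some (length xs)" "list_all2 (\<lambda>x y. (x, y) \<in> \<Union>\<Theta>) xs ys"
  moreover from this(2) obtain \<gamma> where "\<gamma> \<in> \<Theta>" "list_all2 (\<lambda>x y. (x, y) \<in> \<gamma>) xs ys"
    using list_all2_directed_Union[OF assms(1) directed] by blast
  ultimately show "(opn M f xs, opn M f ys) \<in> \<Union>\<Theta>"
    using assms(2) Con_opn[of \<gamma> ty M f xs ys] by blast
qed

lemma pullback_in_Con:
  assumes "is_algebra ty A" "is_hom ty A B h" "\<psi> \<in> Con ty B"
  shows "pullback A h \<psi> \<in> Con ty A"
proof (rule ConI)
  show "pullback A h \<psi> \<subseteq> univ A \<times> univ A"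
    by (auto simp: pullback_def)
next
  fix x y z
  show "x \<in> univ A \<Longrightarrow> (x, x) \<in> pullback A h \<psi>"
    using assms(2,3) by (auto simp: pullback_def is_hom_def intro: Con_refl)
  show "(x, y) \<in> pullback A h \<psi> \<Longrightarrow> (y, x) \<in> pullback A h \<psi>"
    using assms(3) by (auto simp: pullback_def intro: Con_sym)
  show "(x, y) \<in> pullback A h \<psi> \<Longrightarrow> (y, z) \<in> pullback A h \<psi> \<Longrightarrow> (x, z) \<in> pullback A h \<psi>"
    using assms(3) by (auto simp: pullback_def intro: Con_trans)
next
  fix f xs ys
  assume f: "ty f = Some (length xs)" and xs: "list_all2 (\<lambda>x y. (x, y) \<in> pullback A h \<psi>) xs ys"
  \<comment> \<open>The arity of \<open>f\<close> is stated for \<open>xs\<close> only; equal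
    lengths make the homomorphism law available for \<open>ys\<close> too.\<close>
  have len: "length xs = length ys"
    using xs by (rule list_all2_lengthD)
  have sub: "set xs \<subseteq> univ A" "set ys \<subseteq> univ A"
    using list_all2_in_Times[OF xs, of "univ A" "univ A"] by (auto simp: pullback_def)
  have "list_all2 (\<lambda>x y. (x, y) \<in> \<psi>) (map h xs) (map h ys)"
    using xs by (auto simp: list_all2_map1 list_all2_map2 pullback_def elim: list_all2_mono)
  then have "(opn B f (map h xs), opn B f (map h ys)) \<in> \<psi>"
    using f assms(3) by (auto intro: Con_opn)
  then show "(opn A f xs, opn A f ys) \<in> pullback A h \<psi>"
    using f len sub assms(1,2) by (simp add: pullback_def is_hom_def is_algebra_def)
qed

section \<open>Terms and quotients\<close>

lemma eval_cong: "(\<And>i. i \<in> vars t \<Longrightarrow> v i = w i) \<Longrightarrow> eval M v t = eval M w t"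
proof (induction t)
  case (App f ts)
  then have "map (eval M v) ts = map (eval M w) ts" by auto
  then show ?case by (simp only: eval.simps)
qed simp

lemma eval_in_univ:
  assumes "is_algebra ty M"
  shows "is_term ty t \<Longrightarrow> v ` vars t \<subseteq> univ M \<Longrightarrow> eval M v t \<in> univ M"
proof (induction t)
  case (App f ts)
  then have "set (map (eval M v) ts) \<subseteq> univ M"
    by (fastforce simp: list_all_iff)
  moreover have "ty f = Some (length (map (eval M v) ts))" using App.prems by simp
  ultimately show ?case using assms unfolding is_algebra_def eval.simps by blast
qed simp

lemma hom_eval:
  assumes "is_algebra ty A" "is_hom ty A B h"
  shows "is_term ty t \<Longrightarrow> v ` vars t \<subseteq> univ A \<Longrightarrow> h (eval A v t) = eval B (h \<circ> v) t"
proof (induction t)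
  case (App f ts)
  have sub: "is_term ty s \<and> v ` vars s \<subseteq> univ A" if "s \<in> set ts" for s
    using App.prems that by (fastforce simp: list_all_iff)
  then have "set (map (eval A v) ts) \<subseteq> univ A"
    using eval_in_univ[OF assms(1)] by auto
  moreover have "ty f = Some (length (map (eval A v) ts))" using App.prems by simp
  ultimately have "h (opn A f (map (eval A v) ts)) = opn B f (map h (map (eval A v) ts))"
    using assms(2) unfolding is_hom_def by blast
  also have "map h (map (eval A v) ts) = map (eval B (h \<circ> v)) ts"
    using App.IH sub by (simp only: map_map map_eq_conv comp_apply[of h "eval A v"]) blast
  finally show ?case by (simp only: eval.simps)
qed simp

lemma hom_eval4:
  assumes "is_algebra ty A" "is_hom ty A B h" "is_term4 ty t" "{a, b, c, d} \<subseteq> univ A"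
  shows "h (eval4 A t a b c d) = eval4 B t (h a) (h b) (h c) (h d)"
    and "eval4 A t a b c d \<in> univ A"
proof -
  \<comment> \<open>Beyond index 3 the value of \<open>!\<close> is unspecified, so the assignments
    are controlled only on the variables of a 4-ary term.\<close>
  have nth: "[a, b, c, d] ! i \<in> {a, b, c, d} \<and> [h a, h b, h c, h d] ! i = h ([a, b, c, d] ! i)"
    if "i < 4" for i
    using that by (auto simp: less_Suc_eq numeral_eq_Suc)
  have vars: "vars t \<subseteq> {..<4}" and t: "is_term ty t"
    using assms(3) by (auto simp: is_term4_def)
  have univ: "(\<lambda>i. [a, b, c, d] ! i) ` vars t \<subseteq> univ A"
    using vars nth assms(4) by blast
  show "eval4 A t a b c d \<in> univ A"
    unfolding eval4_def by (rule eval_in_univ[OF assms(1) t univ])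
  have "h (eval4 A t a b c d) = eval B (h \<circ> (\<lambda>i. [a, b, c, d] ! i)) t"
    unfolding eval4_def by (rule hom_eval[OF assms(1,2) t univ])
  also have "\<dots> = eval4 B t (h a) (h b) (h c) (h d)"
    unfolding eval4_def using vars nth by (intro eval_cong) auto
  finally show "h (eval4 A t a b c d) = eval4 B t (h a) (h b) (h c) (h d)" .
qed

text \<open>Classes are replaced by chosen representatives, so that the quotient lives in the same
  universe of discourse.\<close>

definition rep :: "('u \<times> 'u) set \<Rightarrow> 'u \<Rightarrow> 'u" where
  "rep \<theta> x = (SOME y. (x, y) \<in> \<theta>)"

definition quot :: "('f, 'u) algebra \<Rightarrow> ('u \<times> 'u) set \<Rightarrow> ('f, 'u) algebra" where
  "quot M \<theta> = \<lparr>univ = rep \<theta> ` univ M, opn = \<lambda>f xs. rep \<theta> (opn M f xs)\<rparr>"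

lemma rep_rel: "\<theta> \<in> Con ty M \<Longrightarrow> x \<in> univ M \<Longrightarrow> (x, rep \<theta> x) \<in> \<theta>"
  unfolding rep_def by (rule someI) (rule Con_refl)

lemma rep_eq_iff:
  assumes "\<theta> \<in> Con ty M" "x \<in> univ M" "y \<in> univ M"
  shows "rep \<theta> x = rep \<theta> y \<longleftrightarrow> (x, y) \<in> \<theta>"
proof
  assume "rep \<theta> x = rep \<theta> y"
  then show "(x, y) \<in> \<theta>"
    using assms rep_rel Con_sym Con_trans by metis
next
  assume "(x, y) \<in> \<theta>"
  \<comment> \<open>Related elements satisfy the same predicate under \<open>SOME\<close>, hence
    receive the same representative.\<close>
  then have "(x, z) \<in> \<theta> \<longleftrightarrow> (y, z) \<in> \<theta>" for z
    using assms(1) Con_sym Con_trans by metis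
  then show "rep \<theta> x = rep \<theta> y" by (simp add: rep_def)
qed

lemma rep_in_univ: "\<theta> \<in> Con ty M \<Longrightarrow> x \<in> univ M \<Longrightarrow> rep \<theta> x \<in> univ M"
  using rep_rel[of \<theta> ty M x] Con_subset[of \<theta> ty M] by blast

lemma quot_is_algebra:
  assumes "is_algebra ty M" "\<theta> \<in> Con ty M"
  shows "is_algebra ty (quot M \<theta>)"
proof -
  have "rep \<theta> ` univ M \<subseteq> univ M" using rep_in_univ[OF assms(2)] by blast
  then show ?thesis
    using assms(1) unfolding is_algebra_def quot_def by (auto dest: order_trans)
qed

text \<open>Each argument is \<theta>-related to its representative, so compatibility relates the
  two results, and related elements have equal representatives.\<close>

lemma rep_is_hom:
  assumes "is_algebra ty M" "\<theta> \<in> Con ty M"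
  shows "is_hom ty M (quot M \<theta>) (rep \<theta>)"
  unfolding is_hom_def
proof (intro conjI allI impI ballI)
  fix f xs
  assume *: "ty f = Some (length xs) \<and> set xs \<subseteq> univ M"
  then have "list_all2 (\<lambda>x y. (x, y) \<in> \<theta>) xs (map (rep \<theta>) xs)"
    by (auto simp: list_all2_map2 rep_rel[OF assms(2)] intro!: list.rel_refl_strong)
  then have "(opn M f xs, opn M f (map (rep \<theta>) xs)) \<in> \<theta>"
    using * Con_opn[OF assms(2)] by blast
  then show "rep \<theta> (opn M f xs) = opn (quot M \<theta>) f (map (rep \<theta>) xs)"
    using rep_eq_iff[OF assms(2)] Con_subset[OF assms(2)] by (auto simp: quot_def)
qed (simp add: quot_def)

text \<open>Identities pass to homomorphic images: an assignment in the quotient lifts, variable by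
  variable, to one in \<open>M\<close>.\<close>

lemma quot_satisfies:
  fixes M :: "('f, 'u) algebra"
  assumes "is_algebra ty M" "\<theta> \<in> Con ty M" "satisfies M e" "is_term ty (fst e)" "is_term ty (snd e)"
  shows "satisfies (quot M \<theta>) e"
  unfolding satisfies_def
proof (intro allI impI)
  fix v :: "nat \<Rightarrow> 'u"
  assume "range v \<subseteq> univ (quot M \<theta>)"
  then have "\<forall>i. \<exists>x\<in>univ M. v i = rep \<theta> x" by (auto simp: quot_def)
  then obtain w where w: "\<And>i. w i \<in> univ M" "\<And>i. v i = rep \<theta> (w i)" by metis
  have v: "v = rep \<theta> \<circ> w" using w(2) by auto
  have eval: "eval (quot M \<theta>) v t = rep \<theta> (eval M w t)" if "is_term ty t" for t
    unfolding v using w(1)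
    by (intro hom_eval[OF assms(1) rep_is_hom[OF assms(1,2)] that, symmetric]) auto
  have "eval M w (fst e) = eval M w (snd e)"
    using assms(3) w(1) by (auto simp: satisfies_def)
  then show "eval (quot M \<theta>) v (fst e) = eval (quot M \<theta>) v (snd e)"
    using eval assms(4,5) by simp
qed

text \<open>Half of the correspondence theorem: a congruence \<eta> above \<theta> projects to a
  congruence of the quotient whose pullback along \<open>rep \<theta>\<close> is \<eta>
  again.\<close>

lemma image_in_Con_quot:
  assumes "is_algebra ty M" "\<theta> \<in> Con ty M" "\<eta> \<in> Con ty M" "\<theta> \<subseteq> \<eta>"
  shows "map_prod (rep \<theta>) (rep \<theta>) ` \<eta> \<in> Con ty (quot M \<theta>)" (is "?E \<in> _")
    and "(x, y) \<in> univ M \<times> univ M \<Longrightarrow>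
      (rep \<theta> x, rep \<theta> y) \<in> map_prod (rep \<theta>) (rep \<theta>) ` \<eta> \<longleftrightarrow> (x, y) \<in> \<eta>"
proof -
  note sub = Con_subset[OF assms(3)]
  have rel: "(x, rep \<theta> x) \<in> \<eta>" if "x \<in> univ M" for x
    using rep_rel[OF assms(2) that] assms(4) by blast
  \<comment> \<open>As every element is \<eta>-related to its representative, the image is just
    \<eta> restricted to representatives, and reflexivity, symmetry and transitivity are
    inherited.\<close>
  have image: "?E = \<eta> \<inter> univ (quot M \<theta>) \<times> univ (quot M \<theta>)"
  proof (intro equalityI subsetI)
    fix p assume "p \<in> ?E"
    then obtain x y where p: "p = (rep \<theta> x, rep \<theta> y)" and xy: "(x, y) \<in> \<eta>" by auto
    then have univ: "x \<in> univ M" "y \<in> univ M" using sub by auto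
    then have "(rep \<theta> x, rep \<theta> y) \<in> \<eta>"
      using rel xy Con_sym[OF assms(3)] Con_trans[OF assms(3)] by metis
    with p univ show "p \<in> \<eta> \<inter> univ (quot M \<theta>) \<times> univ (quot M \<theta>)" by (simp add: quot_def)
  next
    fix p assume "p \<in> \<eta> \<inter> univ (quot M \<theta>) \<times> univ (quot M \<theta>)"
    then obtain x y where p: "p = (rep \<theta> x, rep \<theta> y)" "p \<in> \<eta>" and univ: "x \<in> univ M" "y \<in> univ M"
      by (auto simp: quot_def)
    then have "(x, y) \<in> \<eta>"
      using rel Con_sym[OF assms(3)] Con_trans[OF assms(3)] by metis
    with p show "p \<in> ?E" by force
  qed
  have quot_sub: "univ (quot M \<theta>) \<subseteq> univ M"
    using rep_in_univ[OF assms(2)] by (auto simp: quot_def)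
  show "?E \<in> Con ty (quot M \<theta>)"
    unfolding image
  proof (rule ConI, goal_cases)
    case (5 f xs ys)
    have "list_all2 (\<lambda>x y. (x, y) \<in> \<eta>) xs ys"
      using 5(2) by (auto elim: list_all2_mono)
    then have "(opn M f xs, opn M f ys) \<in> \<eta>"
      using 5(1) Con_opn[OF assms(3)] by blast
    \<comment> \<open>A quotient operation is the operation of \<open>M\<close> followed by
      \<open>rep \<theta>\<close>, so here the description as an image is the convenient
      one.\<close>
    then show ?case
      unfolding image[symmetric] by (auto simp: quot_def intro: rev_image_eqI)
  qed (use quot_sub Con_refl[OF assms(3)] Con_sym[OF assms(3)] Con_trans[OF assms(3)] in blast)+
  show "(rep \<theta> x, rep \<theta> y) \<in> ?E \<longleftrightarrow> (x, y) \<in> \<eta>" if "(x, y) \<in> univ M \<times> univ M"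
  proof
    assume "(rep \<theta> x, rep \<theta> y) \<in> ?E"
    then have "(rep \<theta> x, rep \<theta> y) \<in> \<eta>" unfolding image by blast
    moreover have "(x, rep \<theta> x) \<in> \<eta>" "(y, rep \<theta> y) \<in> \<eta>" using that rel by auto
    ultimately show "(x, y) \<in> \<eta>"
      using Con_sym[OF assms(3)] Con_trans[OF assms(3)] by blast
  next
    assume "(x, y) \<in> \<eta>"
    then show "(rep \<theta> x, rep \<theta> y) \<in> ?E" by force
  qed
qed

section \<open>Joins with finitely generated congruences\<close>

text \<open>The indexed equations of EDPC become a set \<open>P\<close> of pairs of terms, which
  turns every condition on them into one bounded quantifier.\<close>

locale edpc_class =
  fixes ty :: "'f \<rightharpoonup> nat" and C :: "('f, 'u) algebra set" and P :: "('f trm \<times> 'f trm) set"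
  assumes equational: "equational_class ty C"
    and terms: "\<And>s t. (s, t) \<in> P \<Longrightarrow> is_term4 ty s \<and> is_term4 ty t"
    and Cg_eq: "\<And>M a b. M \<in> C \<Longrightarrow> a \<in> univ M \<Longrightarrow> b \<in> univ M \<Longrightarrow>
      Cg ty M a b = {(c, d) \<in> univ M \<times> univ M. \<forall>(s, t)\<in>P. eval4 M s a b c d = eval4 M t a b c d}"
begin

lemma is_algebra_C: "M \<in> C \<Longrightarrow> is_algebra ty M"
  using equational by (auto simp: equational_class_def)

lemma quot_in_C: "M \<in> C \<Longrightarrow> \<theta> \<in> Con ty M \<Longrightarrow> quot M \<theta> \<in> C"
  using equational by (auto simp: equational_class_def intro: quot_is_algebra quot_satisfies)

section \<open>Joining a congruence with one pair\<close>

text \<open>The EDPC equations with equality weakened to \<theta>. When \<theta> is a congruence and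
  the pair lies in \<open>M\<close>, this is the join of \<theta> with the principal congruence of
  the pair, as the lemmas below establish. The pair precedes \<theta> so that \<open>foldr\<close>
  can iterate the construction.\<close>

definition adjoin :: "('f, 'u) algebra \<Rightarrow> 'u \<times> 'u \<Rightarrow> ('u \<times> 'u) set \<Rightarrow> ('u \<times> 'u) set" where
  "adjoin M = (\<lambda>(a, b) \<theta>. {(c, d) \<in> univ M \<times> univ M.
     \<forall>(s, t)\<in>P. (eval4 M s a b c d, eval4 M t a b c d) \<in> \<theta>})"

text \<open>EDPC is applied in the quotient, which again belongs to \<open>C\<close>:
  \<open>rep \<theta>\<close> commutes with the terms, and equality of representatives means being
  \<theta>-related.\<close>

lemma adjoin_eq_pullback:
  assumes M: "M \<in> C" and \<theta>: "\<theta> \<in> Con ty M" and a: "a \<in> univ M" and b: "b \<in> univ M"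
  shows "adjoin M (a, b) \<theta> = pullback M (rep \<theta>) (Cg ty (quot M \<theta>) (rep \<theta> a) (rep \<theta> b))"
proof -
  note alg = is_algebra_C[OF M]
  note eval = hom_eval4[OF alg rep_is_hom[OF alg \<theta>]]
  have rep_univ: "rep \<theta> x \<in> univ (quot M \<theta>)" if "x \<in> univ M" for x
    using that by (simp add: quot_def)
  have "(eval4 M s a b c d, eval4 M t a b c d) \<in> \<theta> \<longleftrightarrow>
      eval4 (quot M \<theta>) s (rep \<theta> a) (rep \<theta> b) (rep \<theta> c) (rep \<theta> d) =
      eval4 (quot M \<theta>) t (rep \<theta> a) (rep \<theta> b) (rep \<theta> c) (rep \<theta> d)"
    if "(s, t) \<in> P" "c \<in> univ M" "d \<in> univ M" for s t c d
    using that terms[OF that(1)] a b by (simp add: eval(1)[symmetric] eval(2) rep_eq_iff[OF \<theta>])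
  then show ?thesis
    using a b rep_univ
    by (fastforce simp: adjoin_def pullback_def Cg_eq[OF quot_in_C[OF M \<theta>]])
qed

lemma adjoin_in_Con:
  assumes "M \<in> C" "\<theta> \<in> Con ty M" "p \<in> univ M \<times> univ M"
  shows "adjoin M p \<theta> \<in> Con ty M"
proof -
  obtain a b where p: "p = (a, b)" by fastforce
  have alg: "is_algebra ty M" "is_algebra ty (quot M \<theta>)"
    using assms is_algebra_C quot_in_C by auto
  have "Cg ty (quot M \<theta>) (rep \<theta> a) (rep \<theta> b) \<in> Con ty (quot M \<theta>)"
    using alg(2) assms(3) by (intro Cg_in_Con) (auto simp: p quot_def)
  then show ?thesis
    unfolding p using assms alg rep_is_hom
    by (subst adjoin_eq_pullback) (auto simp: p intro!: pullback_in_Con)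
qed

text \<open>Pairs of \<theta> collapse to the diagonal of the quotient, which every congruence
  contains, and \<open>p\<close> maps to the generating pair.\<close>

lemma subset_adjoin:
  assumes "M \<in> C" "\<theta> \<in> Con ty M" "p \<in> univ M \<times> univ M"
  shows "insert p \<theta> \<subseteq> adjoin M p \<theta>"
proof -
  obtain a b where p: "p = (a, b)" by fastforce
  have alg: "is_algebra ty (quot M \<theta>)"
    using assms is_algebra_C quot_in_C by auto
  have univ: "rep \<theta> x \<in> univ (quot M \<theta>)" if "x \<in> univ M" for x
    using that by (simp add: quot_def)
  let ?\<gamma> = "Cg ty (quot M \<theta>) (rep \<theta> a) (rep \<theta> b)"
  have \<gamma>: "?\<gamma> \<in> Con ty (quot M \<theta>)"
    using alg assms(3) univ by (intro Cg_in_Con) (auto simp: p)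
  have "(rep \<theta> x, rep \<theta> y) \<in> ?\<gamma>" if "(x, y) \<in> \<theta>" for x y
  proof -
    have "x \<in> univ M" "y \<in> univ M" using that Con_subset[OF assms(2)] by auto
    then show ?thesis
      using that rep_eq_iff[OF assms(2)] Con_refl[OF \<gamma>] univ by metis
  qed
  moreover have "(rep \<theta> a, rep \<theta> b) \<in> ?\<gamma>"
    by (auto simp: Cg_def)
  ultimately show ?thesis
    unfolding p using assms Con_subset[OF assms(2)]
    by (subst adjoin_eq_pullback) (auto simp: p pullback_def)
qed

text \<open>By correspondence, \<eta> projects to a congruence of the quotient that contains the
  generating pair, hence the whole principal congruence; pulling back gives the inclusion.\<close>

lemma adjoin_least:
  assumes "M \<in> C" "\<theta> \<in> Con ty M" "\<eta> \<in> Con ty M" "insert p \<theta> \<subseteq> \<eta>"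
  shows "adjoin M p \<theta> \<subseteq> \<eta>"
proof -
  obtain a b where p: "p = (a, b)" by fastforce
  have ab: "a \<in> univ M" "b \<in> univ M" using assms(3,4) Con_subset p by blast+
  note image = image_in_Con_quot[OF is_algebra_C[OF assms(1)] assms(2,3)]
  have "map_prod (rep \<theta>) (rep \<theta>) ` \<eta> \<in> Con ty (quot M \<theta>)"
    using assms(4) by (intro image) simp
  moreover have "(rep \<theta> a, rep \<theta> b) \<in> map_prod (rep \<theta>) (rep \<theta>) ` \<eta>"
    using assms(4) p by force
  ultimately have "Cg ty (quot M \<theta>) (rep \<theta> a) (rep \<theta> b) \<subseteq> map_prod (rep \<theta>) (rep \<theta>) ` \<eta>"
    unfolding Cg_def by (intro Inter_lower CollectI conjI)
  then have "(x, y) \<in> \<eta>" if "(x, y) \<in> adjoin M p \<theta>" for x y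
    using that image(2)[of x y] assms(4)
    by (auto simp: p adjoin_eq_pullback[OF assms(1,2) ab] pullback_def)
  then show ?thesis by auto
qed

text \<open>The relation \<theta> enters only through a conjunction of membership conditions. For
  congruences this is the seed of distributivity: joining with a principal congruence preserves
  binary intersections.\<close>

lemma adjoin_Int: "adjoin M p (\<alpha> \<inter> \<beta>) = adjoin M p \<alpha> \<inter> adjoin M p \<beta>"
  by (cases p) (auto simp: adjoin_def)

text \<open>Homomorphisms commute with terms, so the condition at the images modulo \<theta> is the
  condition upstairs modulo the pullback of \<theta>. This is the seed of congruence
  extension.\<close>

lemma pullback_adjoin:
  assumes "is_algebra ty A" "is_hom ty A B h" "p \<in> univ A \<times> univ A"
  shows "pullback A h (adjoin B (map_prod h h p) \<theta>) = adjoin A p (pullback A h \<theta>)"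
proof -
  obtain a b where p: "p = (a, b)" by fastforce
  have ab: "a \<in> univ A" "b \<in> univ A" using assms(3) by (auto simp: p)
  note eval = hom_eval4[OF assms(1,2)]
  have h: "h x \<in> univ B" if "x \<in> univ A" for x
    using that assms(2) by (simp add: is_hom_def)
  have "(eval4 B s (h a) (h b) (h c) (h d), eval4 B t (h a) (h b) (h c) (h d)) \<in> \<theta> \<longleftrightarrow>
      (eval4 A s a b c d, eval4 A t a b c d) \<in> pullback A h \<theta>"
    if "(s, t) \<in> P" "c \<in> univ A" "d \<in> univ A" for s t c d
    using that terms[OF that(1)] ab by (simp add: pullback_def eval(2) eval(1)[symmetric])
  moreover have "pullback A h (adjoin B (map_prod h h p) \<theta>) = {(c, d) \<in> univ A \<times> univ A.
      \<forall>(s, t)\<in>P. (eval4 B s (h a) (h b) (h c) (h d), eval4 B t (h a) (h b) (h c) (h d)) \<in> \<theta>}"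
    using h by (auto simp: adjoin_def pullback_def p)
  ultimately show ?thesis
    by (auto simp: adjoin_def p)
qed

section \<open>Joins with finitely many pairs\<close>

abbreviation adjoins :: "('f, 'u) algebra \<Rightarrow> ('u \<times> 'u) list \<Rightarrow> ('u \<times> 'u) set \<Rightarrow> ('u \<times> 'u) set" where
  "adjoins M \<equiv> foldr (adjoin M)"

lemma adjoins_Con:
  assumes "M \<in> C" "\<theta> \<in> Con ty M" "set L \<subseteq> univ M \<times> univ M"
  shows "adjoins M L \<theta> \<in> Con ty M \<and> \<theta> \<union> set L \<subseteq> adjoins M L \<theta>"
  using assms(3)
proof (induction L)
  case (Cons p L)
  then have "adjoins M L \<theta> \<in> Con ty M" "\<theta> \<union> set L \<subseteq> adjoins M L \<theta>" "p \<in> univ M \<times> univ M"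
    by auto
  then show ?case
    using adjoin_in_Con[OF assms(1)] subset_adjoin[OF assms(1)] by fastforce
qed (simp add: assms(2))

lemma adjoins_least:
  assumes "M \<in> C" "\<theta> \<in> Con ty M" "\<eta> \<in> Con ty M" "\<theta> \<union> set L \<subseteq> \<eta>"
  shows "adjoins M L \<theta> \<subseteq> \<eta>"
  using assms(4)
proof (induction L)
  case (Cons p L)
  have "set L \<subseteq> univ M \<times> univ M" using Cons.prems Con_subset[OF assms(3)] by auto
  then show ?case
    using Cons adjoins_Con[OF assms(1,2)] adjoin_least[OF assms(1) _ assms(3)] by simp
qed simp

text \<open>Leastness makes the order and multiplicity of the listed pairs irrelevant, although the
  fold adds them one at a time.\<close>

lemma adjoins_mono:
  assumes "M \<in> C" "\<theta> \<in> Con ty M" "set L \<subseteq> set L'" "set L' \<subseteq> univ M \<times> univ M"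
  shows "adjoins M L \<theta> \<subseteq> adjoins M L' \<theta>"
  using adjoins_Con[OF assms(1,2,4)] assms by (intro adjoins_least) auto

lemma adjoins_Int: "adjoins M L (\<alpha> \<inter> \<beta>) = adjoins M L \<alpha> \<inter> adjoins M L \<beta>"
  by (induction L) (simp_all add: adjoin_Int)

lemma pullback_adjoins:
  assumes "is_algebra ty A" "is_hom ty A B h" "set L \<subseteq> univ A \<times> univ A"
  shows "pullback A h (adjoins B (map (map_prod h h) L) \<theta>) = adjoins A L (pullback A h \<theta>)"
  using assms(3) by (induction L) (simp_all add: pullback_adjoin[OF assms(1,2)])

section \<open>Joins with arbitrary sets of pairs\<close>

text \<open>For a congruence \<theta> and pairs \<open>R\<close> of \<open>M\<close>, this is the
  join of \<theta> with the congruence generated by \<open>R\<close>. The union over finite lists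
  keeps the term description available for each single member.\<close>

definition gen :: "('f, 'u) algebra \<Rightarrow> ('u \<times> 'u) set \<Rightarrow> ('u \<times> 'u) set \<Rightarrow> ('u \<times> 'u) set" where
  "gen M \<theta> R = (\<Union>L\<in>lists R. adjoins M L \<theta>)"

lemma gen_Con:
  assumes "M \<in> C" "\<theta> \<in> Con ty M" "R \<subseteq> univ M \<times> univ M"
  shows "gen M \<theta> R \<in> Con ty M" and "\<theta> \<union> R \<subseteq> gen M \<theta> R"
proof -
  have L: "adjoins M L \<theta> \<in> Con ty M" "\<theta> \<union> set L \<subseteq> adjoins M L \<theta>" if "L \<in> lists R" for L
    using adjoins_Con[OF assms(1,2), of L] that assms(3) by auto
  show "gen M \<theta> R \<in> Con ty M"
    unfolding gen_def
  proof (rule directed_Union_in_Con)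
    fix \<alpha> \<beta>
    assume "\<alpha> \<in> (\<lambda>L. adjoins M L \<theta>) ` lists R" "\<beta> \<in> (\<lambda>L. adjoins M L \<theta>) ` lists R"
    then obtain L K where LK: "L \<in> lists R" "K \<in> lists R"
      and eq: "\<alpha> = adjoins M L \<theta>" "\<beta> = adjoins M K \<theta>" by blast
    \<comment> \<open>Concatenation of lists supplies the upper bound that makes the family
      directed.\<close>
    have "\<alpha> \<union> \<beta> \<subseteq> adjoins M (L @ K) \<theta>"
      unfolding eq using LK assms by (intro Un_least adjoins_mono) auto
    moreover have "adjoins M (L @ K) \<theta> \<in> (\<lambda>L. adjoins M L \<theta>) ` lists R"
      using LK by (intro imageI) simp
    ultimately show "\<exists>\<gamma>\<in>(\<lambda>L. adjoins M L \<theta>) ` lists R. \<alpha> \<union> \<beta> \<subseteq> \<gamma>"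
      by (rule bexI)
  qed (use L lists.Nil in blast)+
  show "\<theta> \<union> R \<subseteq> gen M \<theta> R"
  proof
    fix p assume p: "p \<in> \<theta> \<union> R"
    then obtain L where "L \<in> lists R" "p \<in> \<theta> \<union> set L"
      by (cases "p \<in> \<theta>") (auto intro: that[of "[]"] that[of "[p]"])
    then show "p \<in> gen M \<theta> R"
      unfolding gen_def using L(2) by blast
  qed
qed

text \<open>This is distributivity in the form (\<alpha> \<squnion> \<theta>) \<inter> (\<beta>
  \<squnion> \<theta>) = (\<alpha> \<inter> \<beta>) \<squnion> \<theta> = \<theta>. A given pair
  uses finitely many pairs of \<theta> on each side; over the concatenated list both memberships
  combine by \<open>adjoins_Int\<close>.\<close>

lemma gen_Int_subset:
  assumes "M \<in> C" "\<alpha> \<in> Con ty M" "\<beta> \<in> Con ty M" "\<theta> \<in> Con ty M" "\<alpha> \<inter> \<beta> \<subseteq> \<theta>"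
  shows "gen M \<alpha> \<theta> \<inter> gen M \<beta> \<theta> \<subseteq> \<theta>"
proof
  fix p assume "p \<in> gen M \<alpha> \<theta> \<inter> gen M \<beta> \<theta>"
  then obtain L K where LK: "L \<in> lists \<theta>" "K \<in> lists \<theta>"
    and p: "p \<in> adjoins M L \<alpha>" "p \<in> adjoins M K \<beta>" by (auto simp: gen_def)
  have sets: "set L \<subseteq> \<theta>" "set K \<subseteq> \<theta>" using LK by auto
  then have "set (L @ K) \<subseteq> univ M \<times> univ M"
    using Con_subset[OF assms(4)] by auto
  then have "adjoins M L \<alpha> \<subseteq> adjoins M (L @ K) \<alpha>" "adjoins M K \<beta> \<subseteq> adjoins M (L @ K) \<beta>"
    using assms(1-3) by (intro adjoins_mono; simp)+
  then have "p \<in> adjoins M (L @ K) (\<alpha> \<inter> \<beta>)"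
    unfolding adjoins_Int using p by blast
  also have "\<dots> \<subseteq> \<theta>"
    using assms sets by (intro adjoins_least Int_in_Con) auto
  finally show "p \<in> \<theta>" .
qed

section \<open>Primes over primes\<close>

text \<open>Congruence extension: adding the image of \<psi> to \<theta> creates no pullback pairs
  outside \<psi>. Membership depends on a finite list, which can be moved back to \<open>A\<close>,
  where \<psi> contains everything being joined.\<close>

lemma pullback_gen_subset:
  assumes "A \<in> C" "is_hom ty A B h" "\<psi> \<in> Con ty A" "\<theta> \<in> Con ty B" "pullback A h \<theta> \<subseteq> \<psi>"
  shows "pullback A h (gen B \<theta> (map_prod h h ` \<psi>)) \<subseteq> \<psi>"
proof
  fix p assume "p \<in> pullback A h (gen B \<theta> (map_prod h h ` \<psi>))"
  then obtain L' where "L' \<in> lists (map_prod h h ` \<psi>)" "p \<in> pullback A h (adjoins B L' \<theta>)"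
    by (auto simp: gen_def pullback_def)
  \<comment> \<open>A list of image pairs is the image of a list in \<psi>, as required by
    \<open>pullback_adjoins\<close>.\<close>
  then obtain L where L: "L \<in> lists \<psi>" "p \<in> pullback A h (adjoins B (map (map_prod h h) L) \<theta>)"
    by (auto simp: lists_image)
  have alg: "is_algebra ty A" using assms(1) by (rule is_algebra_C)
  have "set L \<subseteq> univ A \<times> univ A" using L(1) Con_subset[OF assms(3)] by auto
  then have "p \<in> adjoins A L (pullback A h \<theta>)"
    using L(2) pullback_adjoins[OF alg assms(2)] by simp
  also have "\<dots> \<subseteq> \<psi>"
    using assms L(1) alg by (intro adjoins_least pullback_in_Con) auto
  finally show "p \<in> \<psi>" .
qed

text \<open>If \<alpha> \<inter> \<beta> lies in \<theta>, so does the intersection of their joins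
  with \<theta>. Pullback preserves this intersection, primeness of \<psi> puts one pulled-back join
  inside \<psi>, and maximality makes that join equal to \<theta>.\<close>

lemma maximal_over_prime:
  assumes "B \<in> C" "A \<in> C" "is_hom ty A B h" "\<psi> \<in> Spec ty A"
    and "\<theta> \<in> Con ty B" "pullback A h \<theta> = \<psi>"
    and max: "\<And>\<eta>. \<eta> \<in> Con ty B \<Longrightarrow> \<theta> \<subseteq> \<eta> \<Longrightarrow> pullback A h \<eta> \<subseteq> \<psi> \<Longrightarrow> \<eta> = \<theta>"
  shows "\<theta> \<in> Spec ty B"
proof -
  have "\<alpha> \<subseteq> \<theta> \<or> \<beta> \<subseteq> \<theta>"
    if \<alpha>: "\<alpha> \<in> Con ty B" and \<beta>: "\<beta> \<in> Con ty B" and Int: "\<alpha> \<inter> \<beta> \<subseteq> \<theta>" for \<alpha> \<beta>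
  proof -
    note gen = gen_Con[OF assms(1) _ Con_subset[OF assms(5)]]
    have "pullback A h (gen B \<alpha> \<theta>) \<inter> pullback A h (gen B \<beta> \<theta>) \<subseteq> \<psi>"
      using gen_Int_subset[OF assms(1) \<alpha> \<beta> assms(5) Int] assms(6) by (auto simp: pullback_def)
    moreover have "pullback A h (gen B \<alpha> \<theta>) \<in> Con ty A" "pullback A h (gen B \<beta> \<theta>) \<in> Con ty A"
      using pullback_in_Con[OF is_algebra_C[OF assms(2)] assms(3)] gen(1) \<alpha> \<beta> by auto
    ultimately have "pullback A h (gen B \<alpha> \<theta>) \<subseteq> \<psi> \<or> pullback A h (gen B \<beta> \<theta>) \<subseteq> \<psi>"
      using assms(4) by (simp add: Spec_def)
    then have "gen B \<alpha> \<theta> = \<theta> \<or> gen B \<beta> \<theta> = \<theta>"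
      using max gen \<alpha> \<beta> by (meson le_sup_iff)
    then show ?thesis using gen(2) \<alpha> \<beta> by blast
  qed
  \<comment> \<open>The full congruence pulls back to the full congruence of \<open>A\<close>, which
    the prime \<psi> is not.\<close>
  moreover have "\<theta> \<noteq> nabla B"
  proof
    assume "\<theta> = nabla B"
    then have "pullback A h \<theta> = nabla A"
      using assms(3) by (auto simp: pullback_def nabla_def is_hom_def)
    then show False using assms(4,6) by (simp add: Spec_def)
  qed
  ultimately show ?thesis using assms(5) by (simp add: Spec_def)
qed

section \<open>Existence of the prime by Zorn's lemma\<close>

lemma prime_over_prime:
  assumes "A \<in> C" "B \<in> C" "is_hom ty A B h" "\<psi> \<in> Spec ty A" "\<theta> \<in> Con ty B" "pullback A h \<theta> \<subseteq> \<psi>"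
  shows "\<exists>\<psi>\<^sub>1\<in>Spec ty B. \<theta> \<subseteq> \<psi>\<^sub>1 \<and> pullback A h \<psi>\<^sub>1 = \<psi>"
proof -
  have \<psi>: "\<psi> \<in> Con ty A" using assms(4) by (simp add: Spec_def)
  \<comment> \<open>Starting Zorn's lemma above the image of \<psi>, and not merely above \<theta>,
    forces the maximal element to pull back to all of \<psi>.\<close>
  define \<theta>\<^sub>0 where "\<theta>\<^sub>0 = gen B \<theta> (map_prod h h ` \<psi>)"
  have sub: "map_prod h h ` \<psi> \<subseteq> univ B \<times> univ B"
    using Con_subset[OF \<psi>] assms(3) by (auto simp: is_hom_def)
  have \<theta>\<^sub>0: "\<theta>\<^sub>0 \<in> Con ty B" "\<theta> \<union> map_prod h h ` \<psi> \<subseteq> \<theta>\<^sub>0" "pullback A h \<theta>\<^sub>0 \<subseteq> \<psi>"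
    unfolding \<theta>\<^sub>0_def using gen_Con[OF assms(2,5) sub]
      pullback_gen_subset[OF assms(1,3) \<psi> assms(5,6)] by auto
  define F where "F = {\<eta> \<in> Con ty B. \<theta>\<^sub>0 \<subseteq> \<eta> \<and> pullback A h \<eta> \<subseteq> \<psi>}"
  have "\<exists>\<mu>\<in>F. \<forall>\<eta>\<in>F. \<mu> \<subseteq> \<eta> \<longrightarrow> \<eta> = \<mu>"
  proof (rule subset_Zorn_nonempty)
    show "F \<noteq> {}" using \<theta>\<^sub>0 by (auto simp: F_def)
  next
    fix K assume nonempty: "K \<noteq> {}" and "subset.chain F K"
    then have K: "K \<subseteq> F" and chain: "\<And>\<alpha> \<beta>. \<alpha> \<in> K \<Longrightarrow> \<beta> \<in> K \<Longrightarrow> \<alpha> \<subseteq> \<beta> \<or> \<beta> \<subseteq> \<alpha>"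
      by (auto simp: subset_chain_def)
    \<comment> \<open>A chain is directed: the larger of two members contains both.\<close>
    have "\<Union>K \<in> Con ty B"
    proof (rule directed_Union_in_Con[OF nonempty])
      show "K \<subseteq> Con ty B" using K by (auto simp: F_def)
      show "\<exists>\<gamma>\<in>K. \<alpha> \<union> \<beta> \<subseteq> \<gamma>" if "\<alpha> \<in> K" "\<beta> \<in> K" for \<alpha> \<beta>
        using chain[OF that] that by (metis Un_absorb1 Un_absorb2 order_refl)
    qed
    moreover have "\<theta>\<^sub>0 \<subseteq> \<Union>K" "pullback A h (\<Union>K) \<subseteq> \<psi>"
      using K nonempty unfolding F_def pullback_def by blast+
    ultimately show "\<Union>K \<in> F" by (simp add: F_def)
  qed
  then obtain \<mu> where \<mu>: "\<mu> \<in> F" and max: "\<And>\<eta>. \<eta> \<in> F \<Longrightarrow> \<mu> \<subseteq> \<eta> \<Longrightarrow> \<eta> = \<mu>"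
    by blast
  have "map_prod h h ` \<psi> \<subseteq> \<mu>" using \<mu> \<theta>\<^sub>0(2) by (auto simp: F_def)
  then have "\<psi> \<subseteq> pullback A h \<mu>"
    using Con_subset[OF \<psi>] by (auto simp: pullback_def)
  then have pb: "pullback A h \<mu> = \<psi>" using \<mu> by (auto simp: F_def)
  have "\<mu> \<in> Spec ty B"
    using \<mu> max pb by (intro maximal_over_prime[OF assms(2,1,3,4)]) (auto simp: F_def)
  moreover have "\<theta> \<subseteq> \<mu>" using \<mu> \<theta>\<^sub>0(2) by (auto simp: F_def)
  ultimately show ?thesis using pb by blast
qed

end

theorem proposition8p13:
  fixes ty :: "'f \<rightharpoonup> nat"
    and C :: "('f, 'u) algebra set"
  assumes "equational_class ty C"
    and "semi_degenerate ty C"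
    and "EDPC ty C"
  shows "\<forall>A\<in>C. \<forall>B\<in>C. \<forall>f. is_hom ty A B f \<and> admissible ty A B f \<longrightarrow> GU ty A B f"
proof (intro ballI allI impI)
  fix A B f
  assume AB: "A \<in> C" "B \<in> C" and f: "is_hom ty A B f \<and> admissible ty A B f"
  obtain n :: nat and p q where pq: "\<forall>i\<in>{1..n}. is_term4 ty (p i) \<and> is_term4 ty (q i)"
    "\<forall>M\<in>C. \<forall>a\<in>univ M. \<forall>b\<in>univ M. Cg ty M a b = {(c, d) \<in> univ M \<times> univ M.
       \<forall>i\<in>{1..n}. eval4 M (p i) a b c d = eval4 M (q i) a b c d}"
    using assms(3) unfolding EDPC_def by blast
  interpret edpc_class ty C "(\<lambda>i. (p i, q i)) ` {1..n}"
    by unfold_locales (use assms(1) pq in auto)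
  show "GU ty A B f"
    unfolding GU_def
  proof (intro ballI impI)
    fix \<phi> \<psi> \<phi>\<^sub>1
    assume "\<psi> \<in> Spec ty A" "\<phi>\<^sub>1 \<in> Spec ty B" "\<phi> \<subseteq> \<psi> \<and> pullback A f \<phi>\<^sub>1 = \<phi>"
    then show "\<exists>\<psi>\<^sub>1\<in>Spec ty B. \<phi>\<^sub>1 \<subseteq> \<psi>\<^sub>1 \<and> pullback A f \<psi>\<^sub>1 = \<psi>"
      \<comment> \<open>Here \<theta> is \<open>\<phi>\<^sub>1\<close>, whose pullback \<phi> lies
        in \<psi>.\<close>
      using AB f by (intro prime_over_prime) (auto simp: Spec_def)
  qed
qed

end
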